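(* Let $G=(V,E)$ be a finite simple graph and let $$P=\Big\{x\in\mathbb{R}^{E} : \sum_{e\in E(G[U])}x(e)\le |U|-1\ \ \forall\,\emptyset\neq U\subseteq V,\quad x(e)\ge 0\ \ \forall e\in E\Big\}.$$ Then $P$ has circuit diameter at most $9$.
   Context: $G[U]$ is the subgraph of $G$ induced by $U$. Let $B$ be the inequality constraint matrix of the given description of $P$ (there are no equality constraints). The circuits of $P$ are the vectors $g\in\mathbb{R}^E\setminus\{0\}$, normalized to coprime integer components, for which the support of $Bg$ is inclusion-minimal among the supports of $\{Bx : x\in\mathbb{R}^E\setminus\{0\}\}$. A circuit walk of length $k$ in $P$ is a sequence $x_0,\ldots,x_k$ of points of $P$, with $x_0$ an extreme point, such that for each $i=0,\ldots,k-1$, $x_{i+1}=x_i+\epsilon_i g_i$ for some circuit $g_i$ and $\epsilon_i>0$, where $x_i+\epsilon g_i\notin P$ for all $\epsilon>\epsilon_i$. The circuit diameter of $P$ is the maximum, over all ordered pairs $(u,v)$ of extreme points of $P$, of the minimum length of a circuit walk from $u$ to $v$. *)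

theory Defs
  imports
    "HOL-Analysis.Analysis"
    "HOL-Analysis.Finite_Function_Topology"
    "HOL-Library.Extended_Nat"
begin

definition simple_graph :: "'v set \<Rightarrow> 'v set set \<Rightarrow> bool" where
  "simple_graph V E \<longleftrightarrow> finite V \<and> (\<forall>e\<in>E. e \<subseteq> V \<and> card e = 2)"

definition induced_edges :: "'v set set \<Rightarrow> 'v set \<Rightarrow> 'v set set" where
  "induced_edges E U = {e\<in>E. e \<subseteq> U}"

text \<open>
  For finite \<open>E\<close>, the space of real vectors indexed by \<open>E\<close> consists of the finitely supported
  functions that vanish outside \<open>E\<close>. In this representation the library's
  \<^const>\<open>extreme_point_of\<close> and vector operations apply.
\<close>

definition coord_space :: "'e set \<Rightarrow> ('e \<Rightarrow>\<^sub>0 real) set" where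
  "coord_space E = {x. Poly_Mapping.keys x \<subseteq> E}"

text \<open>
  A real matrix with rows indexed by \<open>I\<close> and columns indexed by \<open>E\<close> is a function
  \<open>B :: 'i \<Rightarrow> 'e \<Rightarrow> real\<close>, whose values outside \<open>I \<times> E\<close> are irrelevant.
\<close>

definition mat_vec :: "'e set \<Rightarrow> ('i \<Rightarrow> 'e \<Rightarrow> real) \<Rightarrow> ('e \<Rightarrow>\<^sub>0 real) \<Rightarrow> 'i \<Rightarrow> real" where
  "mat_vec E B x i = (\<Sum>e\<in>E. B i e * Poly_Mapping.lookup x e)"

definition ineq_polyhedron ::
    "'e set \<Rightarrow> 'i set \<Rightarrow> ('i \<Rightarrow> 'e \<Rightarrow> real) \<Rightarrow> ('i \<Rightarrow> real) \<Rightarrow> ('e \<Rightarrow>\<^sub>0 real) set" where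
  "ineq_polyhedron E I B b = {x \<in> coord_space E. \<forall>i\<in>I. mat_vec E B x i \<le> b i}"

definition mat_vec_support ::
    "'e set \<Rightarrow> 'i set \<Rightarrow> ('i \<Rightarrow> 'e \<Rightarrow> real) \<Rightarrow> ('e \<Rightarrow>\<^sub>0 real) \<Rightarrow> 'i set" where
  "mat_vec_support E I B x = {i\<in>I. mat_vec E B x i \<noteq> 0}"

definition coprime_integral :: "'e set \<Rightarrow> ('e \<Rightarrow>\<^sub>0 real) \<Rightarrow> bool" where
  "coprime_integral E g \<longleftrightarrow>
     (\<exists>z :: 'e \<Rightarrow> int. (\<forall>e\<in>E. Poly_Mapping.lookup g e = of_int (z e)) \<and> Gcd (z ` E) = 1)"

text \<open>
  The circuits depend on the chosen description, not only on the polyhedron. Both \<open>g\<close> and \<open>- g\<close>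
  are circuits if one of them is.
\<close>

definition circuits :: "'e set \<Rightarrow> 'i set \<Rightarrow> ('i \<Rightarrow> 'e \<Rightarrow> real) \<Rightarrow> ('e \<Rightarrow>\<^sub>0 real) set" where
  "circuits E I B =
     {g \<in> coord_space E - {0}. coprime_integral E g \<and>
        \<not> (\<exists>x \<in> coord_space E - {0}. mat_vec_support E I B x \<subset> mat_vec_support E I B g)}"

text \<open>In the following, \<open>C\<close> is the set of circuits of (a description of) \<open>P\<close>.\<close>

definition circuit_walk ::
    "'a::real_vector set \<Rightarrow> 'a set \<Rightarrow> nat \<Rightarrow> (nat \<Rightarrow> 'a) \<Rightarrow> bool" where
  "circuit_walk P C k x \<longleftrightarrow>
     (\<forall>i\<le>k. x i \<in> P) \<and> x 0 extreme_point_of P \<and>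
     (\<forall>i<k. \<exists>g\<in>C. \<exists>\<epsilon>>0. x (Suc i) = x i + \<epsilon> *\<^sub>R g \<and>
        (\<forall>\<delta>>\<epsilon>. x i + \<delta> *\<^sub>R g \<notin> P))"

text \<open>The distance is \<open>\<infinity>\<close> if there is no circuit walk from \<open>u\<close> to \<open>v\<close>.\<close>

definition circuit_dist :: "'a::real_vector set \<Rightarrow> 'a set \<Rightarrow> 'a \<Rightarrow> 'a \<Rightarrow> enat" where
  "circuit_dist P C u v =
     (INF k \<in> {k. \<exists>x. circuit_walk P C k x \<and> x 0 = u \<and> x k = v}. enat k)"

definition circuit_diameter :: "'a::real_vector set \<Rightarrow> 'a set \<Rightarrow> enat" where
  "circuit_diameter P C =
     (SUP (u, v) \<in> {u. u extreme_point_of P} \<times> {v. v extreme_point_of P}. circuit_dist P C u v)"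

definition forest_polytope :: "'v set \<Rightarrow> 'v set set \<Rightarrow> ('v set \<Rightarrow>\<^sub>0 real) set" where
  "forest_polytope V E =
     {x \<in> coord_space E.
        (\<forall>U. U \<noteq> {} \<and> U \<subseteq> V \<longrightarrow>
           (\<Sum>e \<in> induced_edges E U. Poly_Mapping.lookup x e) \<le> real (card U) - 1) \<and>
        (\<forall>e\<in>E. Poly_Mapping.lookup x e \<ge> 0)}"

text \<open>
  One row for each nonempty vertex set and one row for each edge; the constraint
  \<open>x(e) \<ge> 0\<close> is the row \<open>- x(e) \<le> 0\<close>.
\<close>

datatype 'v row = Vertex_Set "'v set" | Nonneg "'v set"

definition forest_rows :: "'v set \<Rightarrow> 'v set set \<Rightarrow> 'v row set" where
  "forest_rows V E = Vertex_Set ` {U. U \<noteq> {} \<and> U \<subseteq> V} \<union> Nonneg ` E"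

fun forest_matrix :: "'v row \<Rightarrow> 'v set \<Rightarrow> real" where
  "forest_matrix (Vertex_Set U) e = (if e \<subseteq> U then 1 else 0)"
| "forest_matrix (Nonneg f) e = (if e = f then - 1 else 0)"

fun forest_rhs :: "'v row \<Rightarrow> real" where
  "forest_rhs (Vertex_Set U) = real (card U) - 1"
| "forest_rhs (Nonneg f) = 0"

lemma simple_graph_finite_edges:
  assumes "simple_graph V E"
  shows "finite E"
proof -
  have "E \<subseteq> Pow V" "finite V"
    using assms by (auto simp: simple_graph_def)
  then show ?thesis
    by (meson finite_Pow_iff finite_subset)
qed

lemma forest_polytope_eq_ineq_polyhedron:
  assumes "simple_graph V E"
  shows "forest_polytope V E = ineq_polyhedron E (forest_rows V E) forest_matrix forest_rhs"
proof -
  have fin: "finite E"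
    using assms by (rule simple_graph_finite_edges)
  have 1: "mat_vec E forest_matrix x (Vertex_Set U) =
      (\<Sum>e \<in> induced_edges E U. Poly_Mapping.lookup x e)" for x U
    using fin
    by (auto simp: mat_vec_def induced_edges_def sum.inter_filter intro!: sum.cong)
  have 2: "mat_vec E forest_matrix x (Nonneg f) = - Poly_Mapping.lookup x f" if "f \<in> E" for x f
  proof -
    have "mat_vec E forest_matrix x (Nonneg f) =
        (\<Sum>e\<in>E. if e = f then - Poly_Mapping.lookup x e else 0)"
      unfolding mat_vec_def by (rule sum.cong) auto
    then show ?thesis
      using fin that by simp
  qed
  show ?thesis
    by (auto simp: forest_polytope_def ineq_polyhedron_def forest_rows_def ball_Un 1 2)
qed

end

theory Submission
  imports Defs
begin

text \<open>
  The polytope is the forest polytope of \<open>G\<close>: its extreme points are the characteristic vectors of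
  the forests of \<open>G\<close> (\<open>extreme_point_is_forest\<close>). Indeed, tight sets with a common vertex are closed
  under intersection, so for a point with a fractional coordinate there is a single edge, or a pair
  of edges that no tight set separates, whose weight can be perturbed both ways. So the task is to
  join two forests by few circuit steps.

  The circuits that do this have the form \<open>\<plusminus>(1\<^sub>f - 1\<^sub>A)\<close> for an edge \<open>f\<close> and a set \<open>A\<close> of other
  edges (\<open>signed_trade_vec_is_circuit\<close>). If, for each \<open>a \<in> A\<close>, the vertex set \<open>f \<union> a\<close> spans no
  edge of \<open>A \<union> {f}\<close> other than \<open>f\<close> and \<open>a\<close>, then the row of \<open>f \<union> a\<close> vanishes on this vector and
  forces \<open>x(a) = - x(f)\<close> for any vector \<open>x\<close> with smaller support; so the vector is a circuit. A
  step along it trades the single edge \<open>f\<close> for the whole set \<open>A\<close>, or \<open>A\<close> for \<open>f\<close>. Both trades are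
  steps of maximal length, as the coordinate of \<open>f\<close> would leave the interval \<open>[0,1]\<close>; thus these
  steps are reversible (\<open>trade_step\<close>).

  Take a forest \<open>F\<close> and an edge \<open>f \<in> F\<close>, and split \<open>F - {f}\<close> into the set \<open>A\<close> of edges that meet \<open>f\<close>
  and the set \<open>B\<close> of those that do not. Both \<open>A\<close> and \<open>B\<close> may be traded for \<open>f\<close>: a forest has at most
  two edges on the three vertices of \<open>f\<close> and an adjacent edge, and an edge that could violate the
  condition for \<open>B\<close> would have to connect \<open>f\<close> to another edge, hence meet \<open>f\<close>. So four steps reduce
  \<open>F\<close> to the single edge \<open>f\<close>, namely \<open>F \<rightarrow> A \<union> B \<rightarrow> B \<union> {f} \<rightarrow> B \<rightarrow> {f}\<close>. Between nonempty forests
  \<open>F\<close> and \<open>F'\<close> this gives a walk of length at most \<open>4 + 1 + 4\<close> through \<open>{f}\<close> and \<open>{f'}\<close>, where the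
  middle step trades \<open>f\<close> for \<open>f'\<close>. The empty forest is one step away from every single edge.
\<close>

section \<open>Circuit steps\<close>

definition circuit_step :: "'a::real_vector set \<Rightarrow> 'a set \<Rightarrow> 'a \<Rightarrow> 'a \<Rightarrow> bool" where
  "circuit_step P C x y \<longleftrightarrow>
     y \<in> P \<and> (\<exists>g\<in>C. \<exists>\<epsilon>>0. y = x + \<epsilon> *\<^sub>R g \<and> (\<forall>\<delta>>\<epsilon>. x + \<delta> *\<^sub>R g \<notin> P))"

lemma circuit_dist_le_steps:
  assumes "u extreme_point_of P" and "(circuit_step P C ^^ k) u v"
  shows "circuit_dist P C u v \<le> enat k"
proof -
  obtain x where x: "x 0 = u" "x k = v" "\<And>i. i < k \<Longrightarrow> circuit_step P C (x i) (x (Suc i))"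
    using assms(2) unfolding relpowp_fun_conv by blast
  have "x i \<in> P" if "i \<le> k" for i
  proof (cases i)
    case 0
    then show ?thesis
      using assms(1) x(1) by (simp add: extreme_point_of_def)
  next
    case (Suc j)
    then show ?thesis
      using x(3)[of j] that by (simp add: circuit_step_def)
  qed
  then have "circuit_walk P C k x"
    using assms(1) x by (auto simp: circuit_walk_def circuit_step_def)
  then have "k \<in> {k. \<exists>x. circuit_walk P C k x \<and> x 0 = u \<and> x k = v}"
    using x by blast
  then show ?thesis
    unfolding circuit_dist_def by (rule INF_lower)
qed

section \<open>Characteristic vectors and forests\<close>

definition char_vec :: "'e set \<Rightarrow> ('e \<Rightarrow>\<^sub>0 real)" where
  "char_vec A = (\<Sum>e\<in>A. Poly_Mapping.single e 1)"

lemma lookup_char_vec: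
  assumes "finite A"
  shows "Poly_Mapping.lookup (char_vec A) e = of_bool (e \<in> A)"
  using assms by (simp add: char_vec_def lookup_sum lookup_single when_def of_bool_def)

lemma lookup_scaleR [simp]:
  "Poly_Mapping.lookup (r *\<^sub>R x) e = r * Poly_Mapping.lookup x e" for x :: "'e \<Rightarrow>\<^sub>0 real"
proof -
  have "finite {i. r *\<^sub>R Poly_Mapping.lookup x i \<noteq> 0}"
    by (rule finite_subset[OF _ finite_lookup[of x]]) auto
  then show ?thesis
    by (simp add: scaleR_poly_mapping_def)
qed

lemma in_coord_space_iff:
  "x \<in> coord_space E \<longleftrightarrow> (\<forall>e. e \<notin> E \<longrightarrow> Poly_Mapping.lookup x e = 0)"
  by (auto simp: coord_space_def in_keys_iff)

abbreviation edge_sum :: "'v set set \<Rightarrow> ('v set \<Rightarrow>\<^sub>0 real) \<Rightarrow> 'v set \<Rightarrow> real" where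
  "edge_sum E x U \<equiv> (\<Sum>e \<in> induced_edges E U. Poly_Mapping.lookup x e)"

text \<open>
  Acyclicity of an edge set on \<open>V\<close> enters only through this equivalent sparsity condition, which is
  the one that the polytope imposes on characteristic vectors.
\<close>

definition is_forest :: "'v set \<Rightarrow> 'v set set \<Rightarrow> bool" where
  "is_forest V F \<longleftrightarrow> (\<forall>U. U \<noteq> {} \<and> U \<subseteq> V \<longrightarrow> card (induced_edges F U) < card U)"

lemma is_forest_subset:
  assumes "is_forest V F" "F' \<subseteq> F" "finite F"
  shows "is_forest V F'"
proof -
  have "card (induced_edges F' U) \<le> card (induced_edges F U)" for U
    using assms(2,3) by (intro card_mono) (auto simp: induced_edges_def)
  then show ?thesis
    using assms(1) unfolding is_forest_def by (meson le_less_trans)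
qed

context
  fixes V :: "'v set" and E :: "'v set set"
  assumes graph: "simple_graph V E"
begin

lemma finite_E: "finite E"
  using graph by (rule simple_graph_finite_edges)

lemma finite_V: "finite V"
  using graph by (simp add: simple_graph_def)

lemma edge_subset: "e \<in> E \<Longrightarrow> e \<subseteq> V"
  using graph by (simp add: simple_graph_def)

lemma edge_card: "e \<in> E \<Longrightarrow> card e = 2"
  using graph by (simp add: simple_graph_def)

lemma edge_nonempty: "e \<in> E \<Longrightarrow> e \<noteq> {}"
  using edge_card by force

lemma finite_edge: "e \<in> E \<Longrightarrow> finite e"
  using edge_subset finite_V finite_subset by blast

lemma finite_induced_edges: "finite (induced_edges E U)"
  using finite_E by (simp add: induced_edges_def)

lemma induced_edges_edge:
  assumes "e \<in> E"
  shows "induced_edges E e = {e}"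
proof -
  have "f = e" if "f \<in> E" "f \<subseteq> e" for f
    using that assms by (intro card_subset_eq) (auto simp: finite_edge edge_card)
  then show ?thesis
    using assms by (auto simp: induced_edges_def)
qed

lemma lookup_char_vec_E:
  "F \<subseteq> E \<Longrightarrow> Poly_Mapping.lookup (char_vec F) e = of_bool (e \<in> F)"
  by (simp add: lookup_char_vec finite_subset[OF _ finite_E])

lemma edge_sum_char_vec:
  assumes "F \<subseteq> E"
  shows "edge_sum E (char_vec F) U = real (card (induced_edges F U))"
proof -
  have "edge_sum E (char_vec F) U = (\<Sum>e\<in>induced_edges E U. if e \<in> F then 1 else 0)"
    by (rule sum.cong) (auto simp: lookup_char_vec_E[OF assms])
  also have "\<dots> = real (card (induced_edges E U \<inter> F))"
    using finite_induced_edges by (simp add: sum.If_cases)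
  also have "induced_edges E U \<inter> F = induced_edges F U"
    using assms by (auto simp: induced_edges_def)
  finally show ?thesis .
qed

lemma char_vec_in_polytope_iff:
  assumes "F \<subseteq> E"
  shows "char_vec F \<in> forest_polytope V E \<longleftrightarrow> is_forest V F"
proof -
  have "edge_sum E (char_vec F) U \<le> real (card U) - 1
      \<longleftrightarrow> card (induced_edges F U) < card U" for U
    unfolding edge_sum_char_vec[OF assms] by linarith
  moreover have "char_vec F \<in> coord_space E"
    using assms by (auto simp: in_coord_space_iff lookup_char_vec_E)
  ultimately show ?thesis
    unfolding forest_polytope_def is_forest_def by (simp add: lookup_char_vec_E[OF assms])
qed

lemma polytope_coord_nonneg:
  assumes "x \<in> forest_polytope V E"
  shows "0 \<le> Poly_Mapping.lookup x e"
  using assms by (cases "e \<in> E") (auto simp: forest_polytope_def in_coord_space_iff)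

lemma polytope_edge_sum_le:
  assumes "x \<in> forest_polytope V E" "U \<noteq> {}" "U \<subseteq> V"
  shows "edge_sum E x U \<le> real (card U) - 1"
  using assms by (auto simp: forest_polytope_def)

lemma polytope_coord_le_1:
  assumes "x \<in> forest_polytope V E" "e \<in> E"
  shows "Poly_Mapping.lookup x e \<le> 1"
  using polytope_edge_sum_le[OF assms(1) edge_nonempty[OF assms(2)] edge_subset[OF assms(2)]]
  by (simp add: induced_edges_edge edge_card assms(2))

section \<open>Extreme points are characteristic vectors of forests\<close>

text \<open>
  A direction that respects the tight constraints can be followed a little both ways; its sums over
  vertex sets are bounded so that one step length suits all the slack constraints.
\<close>

lemma not_extreme_if_free_direction:
  assumes x: "x \<in> forest_polytope V E"
    and d: "d \<in> coord_space E" "d \<noteq> 0"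
    and d_coord: "\<And>e. \<bar>Poly_Mapping.lookup d e\<bar> \<le> 1"
      "\<And>e. Poly_Mapping.lookup x e = 0 \<Longrightarrow> Poly_Mapping.lookup d e = 0"
    and d_sum: "\<And>U. \<bar>edge_sum E d U\<bar> \<le> 1"
      "\<And>U. U \<noteq> {} \<Longrightarrow> U \<subseteq> V \<Longrightarrow> edge_sum E x U = real (card U) - 1 \<Longrightarrow> edge_sum E d U = 0"
  shows "\<not> x extreme_point_of forest_polytope V E"
proof
  assume ext: "x extreme_point_of forest_polytope V E"
  define slack where "slack U = real (card U) - 1 - edge_sum E x U" for U
  define S where "S = insert 1 (slack ` {U. U \<noteq> {} \<and> U \<subseteq> V \<and> slack U \<noteq> 0} \<union>
    Poly_Mapping.lookup x ` {e\<in>E. Poly_Mapping.lookup x e \<noteq> 0})"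
  have slack_nonneg: "0 \<le> slack U" if "U \<noteq> {}" "U \<subseteq> V" for U
    using polytope_edge_sum_le[OF x that] by (simp add: slack_def)
  have "finite {U. U \<noteq> {} \<and> U \<subseteq> V \<and> slack U \<noteq> 0}"
    by (rule finite_subset[of _ "Pow V"]) (use finite_V in auto)
  then have fin: "finite S"
    using finite_E by (simp add: S_def)
  have pos: "\<forall>s\<in>S. 0 < s"
    using slack_nonneg polytope_coord_nonneg[OF x] by (auto simp: S_def less_le)
  define \<epsilon> where "\<epsilon> = Min S"
  have "S \<noteq> {}"
    by (simp add: S_def)
  then have eps: "0 < \<epsilon>" "\<And>s. s \<in> S \<Longrightarrow> \<epsilon> \<le> s"
    using fin pos by (auto simp: \<epsilon>_def)
  have mem: "x + c *\<^sub>R d \<in> forest_polytope V E" if c: "\<bar>c\<bar> \<le> \<epsilon>" for c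
  proof -
    have small: "\<bar>c * t\<bar> \<le> \<epsilon>" if "\<bar>t\<bar> \<le> 1" for t
      using mult_mono[OF c that] eps(1) by (simp add: abs_mult)
    have "0 \<le> Poly_Mapping.lookup x e + c * Poly_Mapping.lookup d e" if "e \<in> E" for e
    proof (cases "Poly_Mapping.lookup x e = 0")
      case True
      then show ?thesis
        using d_coord(2) by simp
    next
      case False
      then have "\<epsilon> \<le> Poly_Mapping.lookup x e"
        using that by (intro eps(2)) (auto simp: S_def)
      then show ?thesis
        using small[OF d_coord(1)[of e]] by linarith
    qed
    moreover have "edge_sum E (x + c *\<^sub>R d) U \<le> real (card U) - 1" if U: "U \<noteq> {}" "U \<subseteq> V" for U
    proof -
      have split: "edge_sum E (x + c *\<^sub>R d) U = edge_sum E x U + c * edge_sum E d U"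
        by (simp add: lookup_add sum.distrib sum_distrib_left)
      show ?thesis
      proof (cases "slack U = 0")
        case True
        then show ?thesis
          unfolding split using d_sum(2)[OF U] by (simp add: slack_def)
      next
        case False
        then have "\<epsilon> \<le> slack U"
          using U by (intro eps(2)) (auto simp: S_def)
        then show ?thesis
          unfolding split slack_def using small[OF d_sum(1)[of U]] by linarith
      qed
    qed
    moreover have "x + c *\<^sub>R d \<in> coord_space E"
      using x d(1) by (auto simp: forest_polytope_def in_coord_space_iff lookup_add)
    ultimately show ?thesis
      by (auto simp: forest_polytope_def lookup_add)
  qed
  have "x - \<epsilon> *\<^sub>R d \<in> forest_polytope V E" "x + \<epsilon> *\<^sub>R d \<in> forest_polytope V E"
    using mem[of "- \<epsilon>"] mem[of \<epsilon>] eps(1) by auto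
  moreover have "x \<in> open_segment (x - \<epsilon> *\<^sub>R d) (x + \<epsilon> *\<^sub>R d)"
  proof -
    have "midpoint (x - \<epsilon> *\<^sub>R d) (x + \<epsilon> *\<^sub>R d) = x"
      by (simp add: midpoint_def flip: scaleR_2)
    moreover have "x - \<epsilon> *\<^sub>R d \<noteq> x + \<epsilon> *\<^sub>R d"
    proof
      assume "x - \<epsilon> *\<^sub>R d = x + \<epsilon> *\<^sub>R d"
      then have "Poly_Mapping.lookup (x - \<epsilon> *\<^sub>R d) e = Poly_Mapping.lookup (x + \<epsilon> *\<^sub>R d) e" for e
        by (simp only:)
      then have "Poly_Mapping.lookup d e = 0" for e
        using eps(1) by (simp add: lookup_add lookup_minus)
      then show False
        using d(2) by (simp add: poly_mapping_eqI)
    qed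
    ultimately show ?thesis
      using midpoint_in_open_segment by metis
  qed
  ultimately show False
    using ext by (auto simp: extreme_point_of_def)
qed

text \<open>
  Uncrossing: \<open>U \<mapsto> x(E[U])\<close> is supermodular for \<open>x \<ge> 0\<close>, whereas the bound \<open>|U| - 1\<close> is modular. The
  common vertex matters because the bound fails for the empty set.
\<close>

lemma tight_Int:
  assumes x: "x \<in> forest_polytope V E"
    and T: "T \<subseteq> V" "edge_sum E x T = real (card T) - 1"
    and U: "U \<subseteq> V" "edge_sum E x U = real (card U) - 1"
    and meet: "T \<inter> U \<noteq> {}"
  shows "edge_sum E x (T \<inter> U) = real (card (T \<inter> U)) - 1"
proof -
  let ?I = "induced_edges E"
  have "edge_sum E x T + edge_sum E x U =
      sum (Poly_Mapping.lookup x) (?I T \<union> ?I U) + sum (Poly_Mapping.lookup x) (?I T \<inter> ?I U)"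
    by (rule sum.union_inter[symmetric]) (rule finite_induced_edges)+
  also have "?I T \<inter> ?I U = ?I (T \<inter> U)"
    by (auto simp: induced_edges_def)
  also have "sum (Poly_Mapping.lookup x) (?I T \<union> ?I U) \<le> edge_sum E x (T \<union> U)"
    by (rule sum_mono2)
      (auto simp: finite_induced_edges polytope_coord_nonneg[OF x], auto simp: induced_edges_def)
  finally have "edge_sum E x T + edge_sum E x U \<le> edge_sum E x (T \<union> U) + edge_sum E x (T \<inter> U)"
    by simp
  moreover have "edge_sum E x (T \<union> U) \<le> real (card (T \<union> U)) - 1"
    using T U meet by (intro polytope_edge_sum_le[OF x]) auto
  moreover have "edge_sum E x (T \<inter> U) \<le> real (card (T \<inter> U)) - 1"
    using T U meet by (intro polytope_edge_sum_le[OF x]) auto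
  moreover have "real (card T) + real (card U) = real (card (T \<union> U)) + real (card (T \<inter> U))"
    using card_Un_Int[of T U] T(1) U(1) finite_V finite_subset
    by (metis of_nat_add)
  ultimately show ?thesis
    using T(2) U(2) by linarith
qed

lemma edge_sum_single:
  assumes "e \<in> E"
  shows "edge_sum E (Poly_Mapping.single e 1) U = of_bool (e \<subseteq> U)"
proof -
  have "edge_sum E (Poly_Mapping.single e 1) U = (\<Sum>f\<in>induced_edges E U. if f = e then 1 else 0)"
    by (rule sum.cong) (auto simp: lookup_single when_def)
  then show ?thesis
    using assms finite_induced_edges by (simp add: induced_edges_def)
qed

text \<open>
  Suppose that a coordinate is fractional. If some fractional edge lies in no tight set, it can be
  perturbed alone. Otherwise a smallest tight set that contains a fractional edge contains a second
  one, by integrality of its right-hand side, and by uncrossing no tight set separates the two; so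
  weight can be shifted between them.
\<close>

lemma extreme_point_coords_01:
  assumes ext: "x extreme_point_of forest_polytope V E" and "e \<in> E"
  shows "Poly_Mapping.lookup x e \<in> {0, 1}"
proof (rule ccontr)
  have x: "x \<in> forest_polytope V E"
    using ext by (simp add: extreme_point_of_def)
  define frac where "frac f \<longleftrightarrow> f \<in> E \<and> Poly_Mapping.lookup x f \<notin> {0, 1}" for f
  define tight where
    "tight U \<longleftrightarrow> U \<noteq> {} \<and> U \<subseteq> V \<and> edge_sum E x U = real (card U) - 1" for U
  assume "Poly_Mapping.lookup x e \<notin> {0, 1}"
  then have e: "frac e"
    using assms(2) by (simp add: frac_def)
  show False
  proof (cases "\<exists>U. tight U \<and> e \<subseteq> U")
    case False
    have "\<not> x extreme_point_of forest_polytope V E"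
    proof (rule not_extreme_if_free_direction[OF x])
      let ?d = "Poly_Mapping.single e (1::real)"
      show "?d \<in> coord_space E"
        using assms(2) by (auto simp: coord_space_def)
      show "?d \<noteq> 0"
        by (metis lookup_single_eq lookup_zero zero_neq_one)
      show "\<bar>Poly_Mapping.lookup ?d f\<bar> \<le> 1" for f
        by (simp add: lookup_single when_def)
      show "Poly_Mapping.lookup ?d f = 0" if "Poly_Mapping.lookup x f = 0" for f
        using that e by (auto simp: lookup_single when_def frac_def)
      show "\<bar>edge_sum E ?d U\<bar> \<le> 1" for U
        by (simp add: edge_sum_single assms(2))
      show "edge_sum E ?d U = 0"
        if "U \<noteq> {}" "U \<subseteq> V" "edge_sum E x U = real (card U) - 1" for U
        using that False by (auto simp: edge_sum_single assms(2) tight_def)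
    qed
    then show False
      using ext by contradiction
  next
    case True
    then obtain U0 where "tight U0 \<and> (\<exists>f. frac f \<and> f \<subseteq> U0)"
      using e by blast
    then obtain U where U: "tight U" "\<exists>f. frac f \<and> f \<subseteq> U"
      and least: "\<And>T. tight T \<Longrightarrow> (\<exists>f. frac f \<and> f \<subseteq> T) \<Longrightarrow> card U \<le> card T"
      using ex_has_least_nat[of "\<lambda>U. tight U \<and> (\<exists>f. frac f \<and> f \<subseteq> U)" U0 card] by blast
    obtain f where f: "frac f" "f \<subseteq> U"
      using U(2) by blast
    have fE: "f \<in> E"
      using f(1) by (simp add: frac_def)
    have "\<exists>h. frac h \<and> h \<subseteq> U \<and> h \<noteq> f"
    proof (rule ccontr)
      assume none: "\<not> (\<exists>h. frac h \<and> h \<subseteq> U \<and> h \<noteq> f)"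
      have "Poly_Mapping.lookup x h \<in> \<int>" if "h \<in> induced_edges E U - {f}" for h
        using none that by (auto simp: frac_def induced_edges_def)
      then have "(\<Sum>h\<in>induced_edges E U - {f}. Poly_Mapping.lookup x h) \<in> \<int>"
        by (rule Ints_sum)
      moreover have "edge_sum E x U =
          Poly_Mapping.lookup x f + (\<Sum>h\<in>induced_edges E U - {f}. Poly_Mapping.lookup x h)"
        using f fE by (intro sum.remove) (auto simp: finite_induced_edges, simp add: induced_edges_def)
      moreover have "edge_sum E x U \<in> \<int>"
        using U(1) by (simp add: tight_def)
      ultimately have "Poly_Mapping.lookup x f \<in> \<int>"
        by (metis Ints_diff add_diff_cancel_right')
      then obtain n :: int where n: "Poly_Mapping.lookup x f = of_int n"
        by (auto elim: Ints_cases)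
      then have "0 \<le> n" "n \<le> 1"
        using polytope_coord_nonneg[OF x, of f] polytope_coord_le_1[OF x fE] by auto
      then have "n = 0 \<or> n = 1"
        by auto
      then show False
        using f(1) n by (auto simp: frac_def)
    qed
    then obtain h where h: "frac h" "h \<subseteq> U" "h \<noteq> f"
      by blast
    have hE: "h \<in> E"
      using h(1) by (simp add: frac_def)
    have contains: "U \<subseteq> T" if T: "tight T" "a \<subseteq> T" and a: "frac a" "a \<subseteq> U" for T a
    proof -
      have "a \<noteq> {}"
        using a(1) by (auto simp: frac_def dest: edge_nonempty)
      then have meet: "T \<inter> U \<noteq> {}"
        using T(2) a(2) by blast
      then have "tight (T \<inter> U)"
        using T(1) U(1) by (auto simp: tight_def intro!: tight_Int[OF x])
      then have "card U \<le> card (T \<inter> U)"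
        using least T(2) a by blast
      moreover have "finite U"
        using U(1) finite_V by (auto simp: tight_def intro: finite_subset)
      ultimately have "T \<inter> U = U"
        by (intro card_seteq) auto
      then show ?thesis
        by blast
    qed
    have "\<not> x extreme_point_of forest_polytope V E"
    proof (rule not_extreme_if_free_direction[OF x])
      let ?d = "Poly_Mapping.single f (1::real) - Poly_Mapping.single h 1"
      have sum_d: "edge_sum E ?d T = of_bool (f \<subseteq> T) - of_bool (h \<subseteq> T)" for T
        using edge_sum_single[OF fE, of T] edge_sum_single[OF hE, of T]
        by (simp add: lookup_minus sum_subtractf)
      show "?d \<in> coord_space E"
        using fE hE by (auto simp: in_coord_space_iff lookup_minus lookup_single when_def)
      have "Poly_Mapping.lookup ?d f = 1"
        using h(3) by (simp add: lookup_minus lookup_single when_def)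
      then show "?d \<noteq> 0"
        by auto
      show "\<bar>Poly_Mapping.lookup ?d a\<bar> \<le> 1" for a
        by (simp add: lookup_minus lookup_single when_def)
      show "Poly_Mapping.lookup ?d a = 0" if "Poly_Mapping.lookup x a = 0" for a
        using that f(1) h(1) by (auto simp: lookup_minus lookup_single when_def frac_def)
      show "\<bar>edge_sum E ?d T\<bar> \<le> 1" for T
        unfolding sum_d by simp
      show "edge_sum E ?d T = 0"
        if "T \<noteq> {}" "T \<subseteq> V" "edge_sum E x T = real (card T) - 1" for T
      proof -
        have "tight T"
          using that by (simp add: tight_def)
        then have "f \<subseteq> T \<longleftrightarrow> h \<subseteq> T"
          using contains f h by blast
        then show ?thesis
          unfolding sum_d by simp
      qed
    qed
    then show False
      using ext by contradiction
  qed
qed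

lemma extreme_point_is_forest:
  assumes "x extreme_point_of forest_polytope V E"
  obtains F where "F \<subseteq> E" "is_forest V F" "x = char_vec F"
proof -
  have x: "x \<in> forest_polytope V E"
    using assms by (simp add: extreme_point_of_def)
  define F where "F = {e\<in>E. Poly_Mapping.lookup x e = 1}"
  have F: "F \<subseteq> E"
    by (auto simp: F_def)
  have "x = char_vec F"
  proof (rule poly_mapping_eqI)
    fix e
    show "Poly_Mapping.lookup x e = Poly_Mapping.lookup (char_vec F) e"
    proof (cases "e \<in> E")
      case True
      then show ?thesis
        using extreme_point_coords_01[OF assms True] unfolding lookup_char_vec_E[OF F]
        by (auto simp: F_def)
    next
      case False
      then show ?thesis
        using x unfolding lookup_char_vec_E[OF F]
        by (auto simp: F_def forest_polytope_def in_coord_space_iff)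
    qed
  qed
  then show ?thesis
    using that F x char_vec_in_polytope_iff by blast
qed

section \<open>Trading one edge for a set of edges\<close>

lemma mat_vec_Vertex_Set: "mat_vec E forest_matrix x (Vertex_Set U) = edge_sum E x U"
  using finite_E by (auto simp: mat_vec_def induced_edges_def sum.inter_filter intro!: sum.cong)

lemma mat_vec_Nonneg:
  assumes "f \<in> E"
  shows "mat_vec E forest_matrix x (Nonneg f) = - Poly_Mapping.lookup x f"
proof -
  have "mat_vec E forest_matrix x (Nonneg f) =
      (\<Sum>e\<in>E. if e = f then - Poly_Mapping.lookup x e else 0)"
    unfolding mat_vec_def by (rule sum.cong) auto
  then show ?thesis
    using finite_E assms by simp
qed

text \<open>The condition under which the rows of the sets \<open>f \<union> a\<close> make \<open>1\<^sub>f - 1\<^sub>A\<close> a circuit.\<close>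

definition tradable :: "'v set \<Rightarrow> 'v set set \<Rightarrow> bool" where
  "tradable f A \<longleftrightarrow> f \<in> E \<and> A \<subseteq> E \<and> f \<notin> A \<and>
     (\<forall>a\<in>A. induced_edges (insert f A) (f \<union> a) \<subseteq> {f, a})"

definition trade_vec :: "'v set \<Rightarrow> 'v set set \<Rightarrow> ('v set \<Rightarrow>\<^sub>0 real)" where
  "trade_vec f A = char_vec {f} - char_vec A"

lemma edge_sum_pair:
  assumes "tradable f A" "a \<in> A"
    and zero: "\<And>e. e \<in> E \<Longrightarrow> e \<notin> insert f A \<Longrightarrow> Poly_Mapping.lookup x e = 0"
  shows "edge_sum E x (f \<union> a) = Poly_Mapping.lookup x f + Poly_Mapping.lookup x a"
proof -
  have "edge_sum E x (f \<union> a) = sum (Poly_Mapping.lookup x) {f, a}"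
  proof (rule sum.mono_neutral_right)
    show "finite (induced_edges E (f \<union> a))"
      by (rule finite_induced_edges)
    show "{f, a} \<subseteq> induced_edges E (f \<union> a)"
      using assms(1,2) by (auto simp: tradable_def induced_edges_def)
    show "\<forall>e\<in>induced_edges E (f \<union> a) - {f, a}. Poly_Mapping.lookup x e = 0"
    proof
      fix e
      assume e: "e \<in> induced_edges E (f \<union> a) - {f, a}"
      have "induced_edges (insert f A) (f \<union> a) \<subseteq> {f, a}"
        using assms(1,2) by (simp add: tradable_def)
      then have "e \<notin> insert f A"
        using e by (auto simp: induced_edges_def)
      then show "Poly_Mapping.lookup x e = 0"
        using e by (intro zero) (auto simp: induced_edges_def)
    qed
  qed
  moreover have "f \<noteq> a"
    using assms(1,2) by (auto simp: tradable_def)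
  ultimately show ?thesis
    by simp
qed

lemma signed_trade_vec_is_circuit:
  assumes tr: "tradable f A" and s: "s \<in> {1, -1}"
  shows "s *\<^sub>R trade_vec f A \<in> circuits E (forest_rows V E) forest_matrix"
proof -
  have fE: "f \<in> E" and AE: "A \<subseteq> E" and fA: "f \<notin> A"
    using tr by (auto simp: tradable_def)
  define g where "g = s *\<^sub>R trade_vec f A"
  have g: "Poly_Mapping.lookup g e = s * (of_bool (e = f) - of_bool (e \<in> A))" for e
    using fE by (simp add: g_def trade_vec_def lookup_minus lookup_char_vec_E AE)
  have "g \<in> coord_space E"
    using fE AE by (auto simp: in_coord_space_iff g)
  moreover have "g \<noteq> 0"
  proof -
    have "Poly_Mapping.lookup g f \<noteq> 0"
      using s fA by (auto simp: g)
    then show ?thesis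
      by auto
  qed
  moreover have "coprime_integral E g"
  proof -
    define z :: "'v set \<Rightarrow> int" where
      "z e = (if s = 1 then 1 else -1) * (of_bool (e = f) - of_bool (e \<in> A))" for e
    have "\<forall>e\<in>E. Poly_Mapping.lookup g e = of_int (z e)"
      using s by (auto simp: g z_def)
    moreover have "Gcd (z ` E) = 1"
    proof -
      have "Gcd (z ` E) dvd z f"
        using fE by (intro Gcd_dvd) auto
      also have "z f dvd 1"
        using fA by (simp add: z_def)
      finally have "is_unit (Gcd (z ` E))" .
      then show ?thesis
        by simp
    qed
    ultimately show ?thesis
      unfolding coprime_integral_def by blast
  qed
  moreover have False if "x \<in> coord_space E" "x \<noteq> 0"
    and supp: "mat_vec_support E (forest_rows V E) forest_matrix x
      \<subset> mat_vec_support E (forest_rows V E) forest_matrix g" for x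
  proof -
    have vanish: "mat_vec E forest_matrix x i = 0"
      if "i \<in> forest_rows V E" "mat_vec E forest_matrix g i = 0" for i
      using supp that by (auto simp: mat_vec_support_def)
    have zero: "Poly_Mapping.lookup x e = 0" if e: "e \<in> E" "e \<notin> insert f A" for e
      using vanish[of "Nonneg e"] e by (auto simp: forest_rows_def mat_vec_Nonneg g)
    have neg: "Poly_Mapping.lookup x a = - Poly_Mapping.lookup x f" if a: "a \<in> A" for a
    proof -
      have "edge_sum E g (f \<union> a) = Poly_Mapping.lookup g f + Poly_Mapping.lookup g a"
        by (rule edge_sum_pair[OF tr a]) (simp add: g)
      also have "\<dots> = 0"
        using a fA by (auto simp: g)
      finally have "mat_vec E forest_matrix g (Vertex_Set (f \<union> a)) = 0"
        by (simp only: mat_vec_Vertex_Set)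
      moreover have "f \<union> a \<noteq> {}" "f \<union> a \<subseteq> V"
        using edge_nonempty[OF fE] edge_subset[OF fE] edge_subset[of a] a AE by blast+
      then have "Vertex_Set (f \<union> a) \<in> forest_rows V E"
        unfolding forest_rows_def by blast
      ultimately have "mat_vec E forest_matrix x (Vertex_Set (f \<union> a)) = 0"
        by (rule vanish[rotated])
      then show ?thesis
        using edge_sum_pair[OF tr a, of x] zero by (simp add: mat_vec_Vertex_Set)
    qed
    \<comment> \<open>Thus \<open>x\<close> is a multiple of \<open>g\<close>, and its support cannot be strictly smaller.\<close>
    define c where "c = s * Poly_Mapping.lookup x f"
    have "x = c *\<^sub>R g"
    proof (rule poly_mapping_eqI)
      fix e
      have "s * s = 1"
        using s by auto
      then show "Poly_Mapping.lookup x e = Poly_Mapping.lookup (c *\<^sub>R g) e"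
        using zero[of e] neg[of e] that(1) fA fE AE
        by (cases "e \<in> E"; cases "e \<in> A"; cases "e = f")
          (auto simp: g c_def in_coord_space_iff algebra_simps)
    qed
    moreover from this have "c \<noteq> 0"
      using that(2) by auto
    moreover have "mat_vec E forest_matrix (c *\<^sub>R g) i = c * mat_vec E forest_matrix g i" for i
      by (simp add: mat_vec_def sum_distrib_left algebra_simps)
    ultimately show False
      using supp by (auto simp: mat_vec_support_def)
  qed
  ultimately show ?thesis
    unfolding circuits_def g_def[symmetric] by blast
qed

abbreviation step :: "'v set set \<Rightarrow> 'v set set \<Rightarrow> bool" where
  "step X Y \<equiv> circuit_step (forest_polytope V E) (circuits E (forest_rows V E) forest_matrix)
     (char_vec X) (char_vec Y)"

text \<open>
  The coordinate of \<open>f\<close> limits the step in either direction. In particular \<open>A = {}\<close> is allowed, and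
  then the trade inserts or deletes \<open>f\<close>.
\<close>

lemma trade_step:
  assumes tr: "tradable f A" and X: "X \<subseteq> E" "f \<notin> X" "A \<inter> X = {}"
    and forests: "is_forest V (insert f X)" "is_forest V (X \<union> A)"
  shows "step (X \<union> A) (insert f X)" and "step (insert f X) (X \<union> A)"
proof -
  have fE: "f \<in> E" and AE: "A \<subseteq> E" and fA: "f \<notin> A"
    using tr by (auto simp: tradable_def)
  have sub: "insert f X \<subseteq> E" "X \<union> A \<subseteq> E" "{f} \<subseteq> E"
    using fE AE X by auto
  have mem: "char_vec (insert f X) \<in> forest_polytope V E" "char_vec (X \<union> A) \<in> forest_polytope V E"
    using forests sub by (simp_all add: char_vec_in_polytope_iff)
  have lookup_f [simp]: "Poly_Mapping.lookup (char_vec (insert f X)) f = 1"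
      "Poly_Mapping.lookup (char_vec (X \<union> A)) f = 0"
      "Poly_Mapping.lookup (trade_vec f A) f = 1"
    using X(2) fA
    by (simp_all add: trade_vec_def lookup_minus lookup_char_vec_E[OF sub(1)]
        lookup_char_vec_E[OF sub(2)] lookup_char_vec_E[OF sub(3)] lookup_char_vec_E[OF AE])
  have move: "char_vec (insert f X) = char_vec (X \<union> A) + trade_vec f A"
  proof (rule poly_mapping_eqI)
    fix e
    have "(of_bool (e \<in> insert f X) :: real)
        = of_bool (e \<in> X \<union> A) + (of_bool (e \<in> {f}) - of_bool (e \<in> A))"
      using X(2,3) fA by auto
    then show "Poly_Mapping.lookup (char_vec (insert f X)) e
        = Poly_Mapping.lookup (char_vec (X \<union> A) + trade_vec f A) e"
      by (simp only: trade_vec_def lookup_add lookup_minus lookup_char_vec_E[OF sub(1)]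
          lookup_char_vec_E[OF sub(2)] lookup_char_vec_E[OF sub(3)] lookup_char_vec_E[OF AE])
  qed
  have "char_vec (X \<union> A) + \<delta> *\<^sub>R (1 *\<^sub>R trade_vec f A) \<notin> forest_polytope V E" if "\<delta> > 1" for \<delta>
  proof
    assume "char_vec (X \<union> A) + \<delta> *\<^sub>R (1 *\<^sub>R trade_vec f A) \<in> forest_polytope V E"
    from polytope_coord_le_1[OF this fE] show False
      using that by (simp add: lookup_add)
  qed
  moreover have "1 *\<^sub>R trade_vec f A \<in> circuits E (forest_rows V E) forest_matrix"
    by (rule signed_trade_vec_is_circuit[OF tr]) simp
  moreover have "char_vec (insert f X) = char_vec (X \<union> A) + 1 *\<^sub>R (1 *\<^sub>R trade_vec f A)"
    by (simp add: move)
  ultimately show "step (X \<union> A) (insert f X)"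
    unfolding circuit_step_def using mem(1) zero_less_one by blast
  have "char_vec (insert f X) + \<delta> *\<^sub>R ((-1) *\<^sub>R trade_vec f A) \<notin> forest_polytope V E"
    if "\<delta> > 1" for \<delta>
  proof
    assume "char_vec (insert f X) + \<delta> *\<^sub>R ((-1) *\<^sub>R trade_vec f A) \<in> forest_polytope V E"
    from polytope_coord_nonneg[OF this, of f] show False
      using that by (simp add: lookup_minus)
  qed
  moreover have "(-1) *\<^sub>R trade_vec f A \<in> circuits E (forest_rows V E) forest_matrix"
    by (rule signed_trade_vec_is_circuit[OF tr]) simp
  moreover have "char_vec (X \<union> A) = char_vec (insert f X) + 1 *\<^sub>R ((-1) *\<^sub>R trade_vec f A)"
    by (simp add: move)
  ultimately show "step (insert f X) (X \<union> A)"
    unfolding circuit_step_def using mem(2) zero_less_one by blast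
qed

section \<open>Joining two forests\<close>

lemma tradable_empty: "f \<in> E \<Longrightarrow> tradable f {}"
  by (simp add: tradable_def)

lemma tradable_single: "f \<in> E \<Longrightarrow> h \<in> E \<Longrightarrow> f \<noteq> h \<Longrightarrow> tradable f {h}"
  by (auto simp: tradable_def induced_edges_def)

text \<open>The edge \<open>f\<close> and an edge that meets it span three vertices, so at most two edges of a forest.\<close>

lemma tradable_adjacent_edges:
  assumes F: "F \<subseteq> E" "is_forest V F" and f: "f \<in> F"
  shows "tradable f {a \<in> F - {f}. a \<inter> f \<noteq> {}}"
proof -
  have "induced_edges (insert f A) (f \<union> a) \<subseteq> {f, a}"
    if A: "A = {a \<in> F - {f}. a \<inter> f \<noteq> {}}" and a: "a \<in> A" for A a
  proof -
    have aE: "a \<in> E" and fE: "f \<in> E" and af: "a \<in> F" "a \<noteq> f" "a \<inter> f \<noteq> {}"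
      using F f a A by auto
    have "card (f \<inter> a) > 0"
      using af(3) finite_edge[OF aE] by (simp add: card_gt_0_iff Int_commute)
    then have "card (f \<union> a) \<le> 3"
      using card_Un_Int[OF finite_edge[OF fE] finite_edge[OF aE]] edge_card[OF fE] edge_card[OF aE]
      by linarith
    moreover have "card (induced_edges F (f \<union> a)) < card (f \<union> a)"
      using F(2) edge_subset[OF fE] edge_subset[OF aE] edge_nonempty[OF fE]
      unfolding is_forest_def by blast
    ultimately have "card (induced_edges F (f \<union> a)) \<le> card {f, a}"
      using af(2) by simp
    moreover have "{f, a} \<subseteq> induced_edges F (f \<union> a)"
      using f af by (auto simp: induced_edges_def)
    moreover have "finite (induced_edges F (f \<union> a))"
      using F(1) finite_E by (auto simp: induced_edges_def intro: finite_subset)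
    ultimately have "{f, a} = induced_edges F (f \<union> a)"
      by (metis card_seteq)
    moreover have "insert f A \<subseteq> F"
      using A f by blast
    ultimately show ?thesis
      unfolding induced_edges_def by blast
  qed
  then show ?thesis
    using F(1) f by (auto simp: tradable_def)
qed

text \<open>An edge of \<open>f \<union> b\<close> that is disjoint from \<open>f\<close> lies in \<open>b\<close>, hence equals \<open>b\<close>.\<close>

lemma tradable_disjoint_edges:
  assumes f: "f \<in> E" and B: "B \<subseteq> E" "\<And>b. b \<in> B \<Longrightarrow> b \<inter> f = {}"
  shows "tradable f B"
proof -
  have "f \<notin> B"
    using B(2)[of f] edge_nonempty[OF f] by auto
  moreover have "h = b" if "h \<in> B" "b \<in> B" "h \<subseteq> f \<union> b" for h b
  proof -
    have "h \<subseteq> b"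
      using that B(2)[of h] by blast
    then show ?thesis
      using that B(1) edge_card finite_edge by (metis card_subset_eq subsetD)
  qed
  ultimately show ?thesis
    using f B(1) by (auto simp: tradable_def induced_edges_def)
qed

abbreviation steps :: "nat \<Rightarrow> 'v set set \<Rightarrow> 'v set set \<Rightarrow> bool" where
  "steps k X Y \<equiv>
     (circuit_step (forest_polytope V E) (circuits E (forest_rows V E) forest_matrix) ^^ k)
       (char_vec X) (char_vec Y)"

lemma steps_trans: "steps k X Y \<Longrightarrow> steps l Y Z \<Longrightarrow> steps (k + l) X Z"
  unfolding relpowp_add by blast

lemma steps_4:
  assumes "step X0 X1" "step X1 X2" "step X2 X3" "step X3 X4"
  shows "steps 4 X0 X4"
proof -
  have "steps (Suc 0 + Suc 0 + (Suc 0 + Suc 0)) X0 X4"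
    using assms by (intro steps_trans[of _ _ X2] steps_trans[of _ _ X1] steps_trans[of _ _ X3]) auto
  then show ?thesis
    by (simp add: numeral_eq_Suc)
qed

lemma forest_to_edge:
  assumes F: "F \<subseteq> E" "is_forest V F" and f: "f \<in> F"
  shows "steps 4 F {f}" and "steps 4 {f} F"
proof -
  define A where "A = {a \<in> F - {f}. a \<inter> f \<noteq> {}}"
  define B where "B = {b \<in> F - {f}. b \<inter> f = {}}"
  have F_eq: "insert f (B \<union> A) = F" and disj: "A \<inter> B = {}" "f \<notin> A" "f \<notin> B"
    using f by (auto simp: A_def B_def)
  have fE: "f \<in> E" and BE: "B \<subseteq> E" and AE: "A \<subseteq> E"
    using F f by (auto simp: A_def B_def)
  have tr: "tradable f A" "tradable f B" "tradable f {}"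
    using tradable_adjacent_edges[OF F f] tradable_disjoint_edges[OF fE BE] tradable_empty[OF fE]
    by (auto simp: A_def B_def)
  have sub: "is_forest V Y" if "Y \<subseteq> F" for Y
    using is_forest_subset[OF F(2) that] F(1) finite_subset[OF _ finite_E] by blast
  have forests: "is_forest V (B \<union> A)" "is_forest V (insert f B)" "is_forest V B"
    "is_forest V {f}" "is_forest V F"
    using f by (auto intro!: sub simp: A_def B_def)
  have 1: "step F (B \<union> A)" "step (B \<union> A) F"
    using trade_step[OF tr(3), of "B \<union> A"] disj AE BE forests by (simp_all add: F_eq)
  have 2: "step (B \<union> A) (insert f B)" "step (insert f B) (B \<union> A)"
    using trade_step[OF tr(1), of B] disj BE forests by simp_all
  have 3: "step (insert f B) B" "step B (insert f B)"
    using trade_step[OF tr(3), of B] disj BE forests by simp_all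
  have 4: "step B {f}" "step {f} B"
    using trade_step[OF tr(2), of "{}"] forests by simp_all
  show "steps 4 F {f}"
    by (rule steps_4[OF 1(1) 2(1) 3(1) 4(1)])
  show "steps 4 {f} F"
    by (rule steps_4[OF 4(2) 3(2) 2(2) 1(2)])
qed

lemma forests_joined_within_9:
  assumes F: "F \<subseteq> E" "is_forest V F" and F': "F' \<subseteq> E" "is_forest V F'"
  shows "\<exists>k\<le>9. steps k F F'"
proof -
  have sub: "is_forest V Y" if "Y \<subseteq> F \<or> Y \<subseteq> F'" for Y
    using that is_forest_subset[OF F(2)] is_forest_subset[OF F'(2)] finite_subset[OF F(1) finite_E]
      finite_subset[OF F'(1) finite_E]
    by blast
  have edge_empty: "steps 1 {f} {}" "steps 1 {} {f}" if "f \<in> F \<or> f \<in> F'" for f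
    using trade_step[OF tradable_empty, of f "{}"] sub[of "{f}"] sub[of "{}"] that F(1) F'(1)
    by auto
  show ?thesis
  proof (cases "F = {}")
    case True
    show ?thesis
    proof (cases "F' = {}")
      case True
      have "steps 0 F F'"
        using \<open>F = {}\<close> True by simp
      then show ?thesis
        by blast
    next
      case False
      then obtain f' where f': "f' \<in> F'"
        by blast
      have "steps (1 + 4) F F'"
        unfolding \<open>F = {}\<close> using steps_trans edge_empty(2) forest_to_edge(2)[OF F' f'] f' by blast
      then show ?thesis
        by (intro exI[of _ "1 + 4"]) simp
    qed
  next
    case False
    then obtain f where f: "f \<in> F"
      by blast
    note to_f = forest_to_edge(1)[OF F f]
    show ?thesis
    proof (cases "F' = {}")
      case True
      have "steps (4 + 1) F F'"
        unfolding True using steps_trans to_f edge_empty(1) f by blast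
      then show ?thesis
        by (intro exI[of _ "4 + 1"]) simp
    next
      case False
      then obtain f' where f': "f' \<in> F'"
        by blast
      note from_f' = forest_to_edge(2)[OF F' f']
      show ?thesis
      proof (cases "f = f'")
        case True
        have "steps (4 + 4) F F'"
          using steps_trans to_f from_f' True by blast
        then show ?thesis
          by (intro exI[of _ "4 + 4"]) simp
      next
        case False
        have "tradable f' {f}"
          using f f' F(1) F'(1) False by (intro tradable_single) auto
        then have "step {f} {f'}"
          using trade_step(1)[of f' "{f}" "{}"] sub[of "{f}"] sub[of "{f'}"] f f' by simp
        then have "steps 1 {f} {f'}"
          by (simp only: One_nat_def relpowp_Suc_0)
        then have "steps (4 + (1 + 4)) F F'"
          using steps_trans to_f from_f' by blast
        then show ?thesis
          by (intro exI[of _ "4 + (1 + 4)"]) simp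
      qed
    qed
  qed
qed

end

theorem theorem4p13:
  fixes V :: "'v set" and E :: "'v set set"
  assumes "simple_graph V E"
  shows "circuit_diameter (forest_polytope V E) (circuits E (forest_rows V E) forest_matrix) \<le> 9"
proof -
  let ?P = "forest_polytope V E"
  let ?C = "circuits E (forest_rows V E) forest_matrix"
  have "circuit_dist ?P ?C u v \<le> 9" if u: "u extreme_point_of ?P" and v: "v extreme_point_of ?P" for u v
  proof -
    obtain F where F: "F \<subseteq> E" "is_forest V F" "u = char_vec F"
      using extreme_point_is_forest[OF assms u] .
    obtain F' where F': "F' \<subseteq> E" "is_forest V F'" "v = char_vec F'"
      using extreme_point_is_forest[OF assms v] .
    obtain k where k: "k \<le> 9" "(circuit_step ?P ?C ^^ k) u v"
      using forests_joined_within_9[OF assms F(1,2) F'(1,2)] F(3) F'(3) by blast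
    have "circuit_dist ?P ?C u v \<le> enat k"
      using u k(2) by (rule circuit_dist_le_steps)
    also have "enat k \<le> 9"
      using k(1) by (simp add: numeral_eq_enat)
    finally show ?thesis .
  qed
  then show ?thesis
    unfolding circuit_diameter_def by (intro SUP_least) auto
qed

end
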